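(* Let $p_1<p_2<p_3<\cdots$ be the sequence of all prime numbers in increasing order. For every $s\in\mathbb{C}$ with $\Re(s)>1$, the Riemann zeta function can be written as \[ \zeta(s)=1+\sum_{k=1}^\infty a_k(s)\, p_k^{-s}, \qquad\text{where}\qquad a_k(s)=\prod_{j=k}^\infty (1-p_j^{-s})^{-1}. \]
   Context: For $\Re(s)>1$, $\zeta(s)=\sum_{n=1}^\infty n^{-s}$ is the Riemann zeta function. The infinite product $\prod_{j=k}^\infty (1-p_j^{-s})^{-1}$ is the limit as $i\to\infty$ of the finite products $\prod_{j=k}^i (1-p_j^{-s})^{-1}$, and the infinite sum over $k$ is the limit of its partial sums. For a prime $p$, $p^{-s}=\exp(-s\ln p)$ with $\ln p$ the real logarithm. *)

theory Defs
  imports "HOL-Analysis.Analysis" "HOL-Computational_Algebra.Primes"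
begin

text \<open>The Dirichlet series, used only for \<open>Re s > 1\<close>. On positive reals \<open>Ln\<close> is the real
  logarithm, so \<open>of_nat n powr (- s)\<close> is \<open>exp (- s * ln n)\<close>.\<close>

definition zeta :: "complex \<Rightarrow> complex" where
  "zeta s = (\<Sum>n. of_nat (Suc n) powr (- s))"

text \<open>Indexed from 1; the value at 0 is irrelevant.\<close>

definition nth_prime :: "nat \<Rightarrow> nat" where
  "nth_prime k = enumerate {p::nat. prime p} (k - 1)"

definition euler_partial :: "complex \<Rightarrow> nat \<Rightarrow> nat \<Rightarrow> complex" where
  "euler_partial s k i = (\<Prod>j=k..i. inverse (1 - of_nat (nth_prime j) powr (- s)))"

definition euler_tail :: "nat \<Rightarrow> complex \<Rightarrow> complex" where
  "euler_tail k s = lim (euler_partial s k)"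

end

theory Submission
  imports Defs
begin

text \<open>Since \<open>a\<^sub>k p\<^sub>k\<^sup>-\<^sup>s = a\<^sub>k - a\<^sub>k\<^sub>+\<^sub>1\<close>, the series telescopes to \<open>a\<^sub>1 - lim a\<^sub>k\<close>. Sieving the
  Dirichlet series by \<open>p\<^sub>1, \<dots>, p\<^sub>k\<close> multiplies \<open>\<zeta>(s)\<close> by \<open>\<Prod>j\<le>k. (1 - p\<^sub>j\<^sup>-\<^sup>s)\<close> and leaves the
  term 1 plus a part of the tail beyond \<open>k\<close>. So these products tend to \<open>1 / \<zeta>(s)\<close>, whence
  \<open>a\<^sub>k = \<zeta>(s) \<cdot> (\<Prod>j<k. (1 - p\<^sub>j\<^sup>-\<^sup>s))\<close> tends to 1 and \<open>a\<^sub>1 = \<zeta>(s)\<close>.\<close>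

text \<open>Induction on the set of primes sieved out. The multiples of a new prime \<open>q\<close>
  among the surviving numbers are exactly \<open>q\<close> times the survivors, so by
  multiplicativity they carry the fraction \<open>f q\<close> of the current sum; removing them
  multiplies it by \<open>1 - f q\<close>.\<close>

lemma has_sum_sieve:
  fixes f :: "nat \<Rightarrow> 'a::real_normed_field"
  assumes mult: "\<And>m n. f (m * n) = f m * f n"
    and sum: "(f has_sum z) {0<..}"
    and "finite P" and "\<And>p. p \<in> P \<Longrightarrow> prime p"
  shows "(f has_sum (z * (\<Prod>p\<in>P. 1 - f p))) {n. n > 0 \<and> (\<forall>p\<in>P. \<not> p dvd n)}"
  using assms(3,4)
proof (induction P rule: finite_induct)
  case empty
  show ?case using sum by (simp add: greaterThan_def)
next
  case (insert q P)
  let ?S = "{n. n > 0 \<and> (\<forall>p\<in>P. \<not> p dvd n)}"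
  let ?w = "z * (\<Prod>p\<in>P. 1 - f p)"
  have IH: "(f has_sum ?w) ?S" using insert by auto
  have q: "prime q" and P: "\<And>p. p \<in> P \<Longrightarrow> prime p" using insert.prems by auto
  have "q > 0" using q prime_gt_0_nat by auto
  have "((\<lambda>n. f q * f n) has_sum (f q * ?w)) ?S"
    using IH by (rule has_sum_cmult_right)
  then have "((f \<circ> (*) q) has_sum (f q * ?w)) ?S"
    by (simp add: o_def mult)
  moreover have "inj_on ((*) q) ?S"
    using \<open>q > 0\<close> by (auto simp: inj_on_def)
  ultimately have multiples: "(f has_sum (f q * ?w)) ((*) q ` ?S)"
    by (subst has_sum_reindex)
  \<comment> \<open>Distinctness of the primes is what keeps the surviving set closed under
    multiplication by \<open>q\<close>.\<close>
  have indivisible: "\<not> p dvd q" if "p \<in> P" for p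
    using that insert.hyps P[OF that] q primes_dvd_imp_eq by blast
  have "(*) q ` ?S \<subseteq> ?S"
    using indivisible \<open>q > 0\<close> P by (auto simp: prime_dvd_mult_iff)
  then have "(f has_sum (?w - f q * ?w)) (?S - (*) q ` ?S)"
    using IH multiples by (intro has_sum_Diff)
  moreover have "?S - (*) q ` ?S = {n. n > 0 \<and> (\<forall>p\<in>insert q P. \<not> p dvd n)}"
  proof -
    have "n \<in> (*) q ` ?S \<longleftrightarrow> q dvd n" if "n \<in> ?S" for n
    proof
      assume "q dvd n"
      then obtain m where "n = q * m" by (elim dvdE)
      moreover have "m \<in> ?S" using that \<open>n = q * m\<close> by auto
      ultimately show "n \<in> (*) q ` ?S" by blast
    qed auto
    then show ?thesis by blast
  qed
  moreover have "?w - f q * ?w = z * (\<Prod>p\<in>insert q P. 1 - f p)"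
    using insert.hyps by (simp add: algebra_simps)
  ultimately show ?case by simp
qed

lemma nth_prime_Suc: "nth_prime (Suc k) = enumerate {p. prime p} k"
  by (simp add: nth_prime_def)

lemma prime_nth_prime: "prime (nth_prime k)"
  using enumerate_in_set[OF primes_infinite] by (simp add: nth_prime_def)

lemma nth_prime_neq_1: "nth_prime k \<noteq> Suc 0"
  using prime_gt_1_nat[OF prime_nth_prime[of k]] by simp

lemma inj_on_nth_prime: "inj_on nth_prime {1..k}"
proof -
  have "strict_mono (enumerate {p::nat. prime p})"
    by (rule strict_mono_enumerate[OF primes_infinite])
  then show ?thesis
    by (auto simp: inj_on_def nth_prime_def strict_mono_eq)
qed

lemma nth_prime_exhausts:
  assumes "prime p"
  obtains j where "j \<ge> 1" "nth_prime j = p"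
proof -
  obtain k where "enumerate {p::nat. prime p} k = p"
    using enumerate_Ex[of "{p::nat. prime p}" p] primes_infinite assms by auto
  then show ?thesis using that[of "Suc k"] by (simp add: nth_prime_Suc)
qed

text \<open>A crude growth bound suffices: it turns a large index of a prime factor into a large
  number, which places the sieve error in a tail of the series.\<close>

lemma nth_prime_ge: "k \<le> nth_prime k"
proof (cases k)
  case (Suc i)
  \<comment> \<open>Strict, because \<open>enumerate\<close> counts from 0 while
    \<open>nth_prime\<close> counts from 1.\<close>
  have "i < enumerate {p::nat. prime p} i"
  proof (induction i)
    case 0
    show ?case
      using enumerate_in_set[OF primes_infinite, of 0] prime_gt_0_nat by blast
  next
    case (Suc i)
    then show ?case
      using enumerate_step[OF primes_infinite, of i] by linarith
  qed
  then show ?thesis using Suc by (simp add: nth_prime_Suc)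
qed simp

text \<open>Stated without reciprocals, so that no factor has to be known to be nonzero; that the
  sum itself is nonzero can then be read off from the limit 1.\<close>

lemma euler_product_inverse_tendsto:
  fixes f :: "nat \<Rightarrow> 'a::{real_normed_field,banach}"
  assumes mult: "\<And>m n. f (m * n) = f m * f n" and one: "f 1 = 1"
    and summable: "summable (\<lambda>n. norm (f n))"
  shows "(\<lambda>k. (\<Sum>n. f (Suc n)) * (\<Prod>j=1..k. 1 - f (nth_prime j))) \<longlonglongrightarrow> 1"
proof -
  let ?z = "\<Sum>n. f (Suc n)"
  let ?S = "\<lambda>k. {n. n > 0 \<and> (\<forall>p\<in>nth_prime ` {1..k}. \<not> p dvd n)}"
  have abs: "f abs_summable_on UNIV"
    using summable summable_on_UNIV_nonneg_real_iff[of "\<lambda>n. norm (f n)"] by simp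
  have "(\<lambda>n. f (Suc n)) sums ?z" "summable (\<lambda>n. norm (f (Suc n)))"
    using summable summable_Suc_iff[of f] summable_norm_cancel[of f]
      summable_Suc_iff[of "\<lambda>n. norm (f n)"] by auto
  then have "((f \<circ> Suc) has_sum ?z) UNIV"
    using norm_summable_imp_has_sum[of "\<lambda>n. f (Suc n)"] by (simp add: o_def)
  then have "(f has_sum ?z) (range Suc)"
    by (subst has_sum_reindex) auto
  moreover have "range Suc = {0<..}"
    using gr0_conv_Suc by auto
  ultimately have full: "(f has_sum ?z) {0<..}" by simp
  have bound: "norm (?z * (\<Prod>j=1..k. 1 - f (nth_prime j)) - 1) \<le> (\<Sum>n. norm (f (n + k)))" for k
  proof -
    let ?w = "?z * (\<Prod>j=1..k. 1 - f (nth_prime j))"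
    have "(f has_sum (?z * (\<Prod>p\<in>nth_prime ` {1..k}. 1 - f p))) (?S k)"
      using full by (rule has_sum_sieve[OF mult]) (auto simp: prime_nth_prime)
    then have "(f has_sum ?w) (?S k)"
      unfolding prod.reindex[OF inj_on_nth_prime] o_def .
    moreover have "(f has_sum f 1) {1}"
      using has_sum_finite[of "{1}" f] by simp
    moreover have "{1} \<subseteq> ?S k"
      by (auto simp: nth_prime_neq_1)
    ultimately have sieved: "(f has_sum (?w - 1)) (?S k - {1})"
      using has_sum_Diff[of f "?S k" ?w "{1}" "f 1"] one by simp
    \<comment> \<open>A survivor other than 1 has a prime factor, which must be some
      \<open>nth_prime j\<close> with \<open>j > k\<close>; hence \<open>n\<close> is at least
      \<open>nth_prime j\<close>, which is at least \<open>j\<close>.\<close>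
    have "n \<ge> k" if "n \<in> ?S k - {1}" for n
    proof -
      have "n > 0" "n \<noteq> 1" using that by auto
      obtain p where p: "prime p" "p dvd n"
        using prime_factor_nat \<open>n \<noteq> 1\<close> by blast
      obtain j where j: "j \<ge> 1" "nth_prime j = p"
        using nth_prime_exhausts p(1) by blast
      have "\<not> j \<le> k" using that p j by force
      then show ?thesis
        using nth_prime_ge[of j] j dvd_imp_le[OF p(2) \<open>n > 0\<close>] by linarith
    qed
    then have sub: "?S k - {1} \<subseteq> {k..}" by auto
    have "summable (\<lambda>n. norm (f (n + k)))"
      using summable by (simp add: summable_iff_shift[of "\<lambda>n. norm (f n)"])
    then have "((\<lambda>n. norm (f (n + k))) has_sum (\<Sum>n. norm (f (n + k)))) UNIV"
      by (intro norm_summable_imp_has_sum) (auto simp: summable_sums)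
    moreover have "range (\<lambda>n. n + k) = {k..}"
      using le_Suc_ex by (fastforce simp: image_iff add.commute)
    moreover have "inj (\<lambda>n. n + k)" by simp
    ultimately have tail: "((\<lambda>n. norm (f n)) has_sum (\<Sum>n. norm (f (n + k)))) {k..}"
      using has_sum_reindex[of "\<lambda>n. n + k" UNIV "\<lambda>n. norm (f n)"] by (simp add: o_def)
    have abs': "f abs_summable_on (?S k - {1})"
      using abs summable_on_subset_banach by blast
    have "norm (?w - 1) = norm (infsum f (?S k - {1}))"
      using infsumI[OF sieved] by simp
    also have "\<dots> \<le> (\<Sum>\<^sub>\<infinity>n\<in>?S k - {1}. norm (f n))"
      by (rule norm_infsum_bound[OF abs'])
    also have "\<dots> \<le> (\<Sum>\<^sub>\<infinity>n\<in>{k..}. norm (f n))"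
      using abs' tail sub by (intro infsum_mono_neutral) (auto intro: has_sum_imp_summable)
    also have "\<dots> = (\<Sum>n. norm (f (n + k)))"
      using infsumI[OF tail] .
    finally show ?thesis .
  qed
  have "(\<lambda>k. \<Sum>n. norm (f (n + k))) \<longlonglongrightarrow> 0"
    by (rule suminf_exist_split2[OF summable])
  then have "(\<lambda>k. ?z * (\<Prod>j=1..k. 1 - f (nth_prime j)) - 1) \<longlonglongrightarrow> 0"
    by (rule Lim_null_comparison[rotated]) (simp only: bound eventually_True)
  then show ?thesis
    by (rule LIM_zero_cancel)
qed

theorem mainTheorem1:
  fixes s :: complex
  assumes "Re s > 1"
  shows "(\<forall>k\<ge>1. convergent (euler_partial s k)) \<and>
         summable (\<lambda>k. euler_tail (Suc k) s * of_nat (nth_prime (Suc k)) powr (- s)) \<and>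
         zeta s = 1 + (\<Sum>k. euler_tail (Suc k) s * of_nat (nth_prime (Suc k)) powr (- s))"
proof -
  define f :: "nat \<Rightarrow> complex" where "f n = of_nat n powr (- s)" for n
  define Q where "Q k = (\<Prod>j=1..k. 1 - f (nth_prime j))" for k
  \<comment> \<open>No branch problem arises: the bases are nonnegative reals, and
    \<open>0 powr z = 0\<close> covers a zero factor.\<close>
  have mult: "f (m * n) = f m * f n" for m n
    using powr_times_real[of "of_nat m" "of_nat n" "- s"] by (simp add: f_def)
  have norm_f: "norm (f n) = real n powr (- Re s)" for n
    using norm_powr_real_powr[of "of_nat n" "- s"] by (simp add: f_def)
  have "summable (\<lambda>n. norm (f n))"
    using assms by (simp add: norm_f summable_real_powr_iff)
  then have zQ: "(\<lambda>k. zeta s * Q k) \<longlonglongrightarrow> 1"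
    using euler_product_inverse_tendsto[of f] mult
    by (simp add: zeta_def f_def Q_def)
  \<comment> \<open>Otherwise the constant sequence 0 would converge to 1.\<close>
  then have z: "zeta s \<noteq> 0"
    using LIMSEQ_const_iff[of "0::complex" 1] by auto
  have factor: "1 - f (nth_prime j) \<noteq> 0" for j
  proof -
    have "real (nth_prime j) > 1"
      using prime_gt_1_nat[OF prime_nth_prime] by simp
    then have "norm (f (nth_prime j)) < 1"
      using assms powr_less_one[of "real (nth_prime j)" "- Re s"] by (simp add: norm_f)
    then show ?thesis by auto
  qed
  have Q0: "Q k \<noteq> 0" for k
    using factor by (simp add: Q_def)
  have tail_lim: "euler_partial s (Suc k) \<longlonglongrightarrow> zeta s * Q k" for k
  proof -
    \<comment> \<open>A finite piece of the product is the quotient of \<open>Q k\<close> by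
      \<open>Q i\<close>. Expanding by \<open>zeta s\<close> puts the dependence on \<open>i\<close>
      into \<open>zeta s * Q i\<close>, whose limit 1 is known and may be inverted.\<close>
    have "euler_partial s (Suc k) i = zeta s * Q k * inverse (zeta s * Q i)" if "i \<ge> k" for i
    proof -
      have "{1..i} = {1..k} \<union> {Suc k..i}" using that by auto
      then have "Q i = Q k * (\<Prod>j=Suc k..i. 1 - f (nth_prime j))"
        by (simp add: Q_def prod.union_disjoint)
      then have "inverse (\<Prod>j=Suc k..i. 1 - f (nth_prime j)) = Q k * inverse (Q i)"
        using Q0[of k] by simp
      also have "\<dots> = zeta s * Q k * inverse (zeta s * Q i)"
        using z by simp
      finally show ?thesis
        by (simp add: euler_partial_def f_def prod_inversef[symmetric] o_def)
    qed
    then have "\<forall>\<^sub>F i in sequentially.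
        zeta s * Q k * inverse (zeta s * Q i) = euler_partial s (Suc k) i"
      by (intro eventually_sequentiallyI[of k]) simp
    moreover have "(\<lambda>i. zeta s * Q k * inverse (zeta s * Q i)) \<longlonglongrightarrow> zeta s * Q k * inverse 1"
      by (intro tendsto_intros zQ) auto
    ultimately show ?thesis
      using tendsto_cong by fastforce
  qed
  then have tail: "euler_tail (Suc k) s = zeta s * Q k" for k
    by (simp add: euler_tail_def limI)
  \<comment> \<open>The first term gives \<open>zeta s\<close> since \<open>Q 0\<close> is the empty
    product, and the limit of the terms gives the subtracted 1.\<close>
  have "(\<lambda>k. zeta s * Q k - zeta s * Q (Suc k)) sums (zeta s * Q 0 - 1)"
    by (rule telescope_sums'[OF zQ])
  moreover have "zeta s * Q k - zeta s * Q (Suc k) =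
      euler_tail (Suc k) s * of_nat (nth_prime (Suc k)) powr (- s)" for k
    by (simp add: tail Q_def f_def algebra_simps)
  ultimately have "(\<lambda>k. euler_tail (Suc k) s * of_nat (nth_prime (Suc k)) powr (- s))
      sums (zeta s - 1)"
    by (simp add: Q_def)
  moreover have "convergent (euler_partial s k)" if "k \<ge> 1" for k
    using tail_lim[of "k - 1"] that by (auto simp: convergent_def)
  ultimately show ?thesis
    by (simp add: sums_iff)
qed

end
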